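(* Let $P$ be a lattice symmetric Fano polygon. Then $P$ is not symmetric if and only if $Aut(P)\cong\mathbb{Z}/2$ is generated by a reflection. In this case $P$ is unimodularly equivalent to the Fano polygon $$P_{m,n}=\mathrm{conv}\{(m+1,-m),(-m,m+1),(-n-1,n),(n,-n-1)\}$$ for some integers $m$ and $n$ satisfying $m\neq n$, and $P$ is not Kähler–Einstein.
   Context: A Fano polygon $P\subset\mathbb{R}^2$ is a two-dimensional convex lattice polygon (with respect to $\mathbb{Z}^2$) whose vertices are primitive lattice points and which contains the origin in its interior. $Aut(P)$ is the group of all elements of $GL_2(\mathbb{Z})$ preserving $P$. A reflection is an element of $GL_2(\mathbb{Z})$ of order $2$ with determinant $-1$. Two polygons are unimodularly equivalent if some element of $GL_2(\mathbb{Z})$ maps one onto the other. $P$ is symmetric if the origin is the only point fixed by all elements of $Aut(P)$; $P$ is lattice symmetric if the origin is the only lattice point of $P$ fixed by all elements of $Aut(P)$. The dual polygon is $P^*=\{w\in\mathbb{R}^2 : \langle w,v\rangle\geq -1 \text{ for every } v\in P\}$, and $P$ is Kähler–Einstein if the barycenter of $P^*$ is the origin. *)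

theory Defs
  imports "HOL-Analysis.Analysis" "HOL-Algebra.Elementary_Groups" "HOL-Algebra.Multiplicative_Group"
begin

definition lattice :: "(real^2) set" where
  "lattice = {x. \<forall>i. x $ i \<in> \<int>}"

definition primitive_point :: "real^2 \<Rightarrow> bool" where
  "primitive_point x \<longleftrightarrow> (\<exists>a b :: int. coprime a b \<and> x = vector [of_int a, of_int b])"

definition fano_polygon :: "(real^2) set \<Rightarrow> bool" where
  "fano_polygon P \<longleftrightarrow> polytope P \<and> aff_dim P = 2 \<and>
     (\<forall>v. v extreme_point_of P \<longrightarrow> primitive_point v) \<and> 0 \<in> interior P"

text \<open>For integer matrices, \<^const>\<open>invertible\<close> asks for an inverse with integer entries.\<close>

definition GL2Z :: "(int^2^2) monoid" where
  "GL2Z = \<lparr>carrier = {A. invertible A}, mult = (**), one = mat 1\<rparr>"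

lemma group_GL2Z: "group GL2Z"
proof (rule groupI)
  fix A assume "A \<in> carrier GL2Z"
  then obtain B where "A ** B = mat 1" "B ** A = mat 1"
    by (auto simp: GL2Z_def invertible_def)
  then show "\<exists>B\<in>carrier GL2Z. B \<otimes>\<^bsub>GL2Z\<^esub> A = \<one>\<^bsub>GL2Z\<^esub>"
    by (auto simp: GL2Z_def invertible_def)
qed (auto simp: GL2Z_def invertible_mult matrix_mul_assoc invertible_def[of "mat 1"])

definition act :: "int^2^2 \<Rightarrow> real^2 \<Rightarrow> real^2" where
  "act A x = map_matrix of_int A *v x"

definition Aut :: "(real^2) set \<Rightarrow> (int^2^2) monoid" where
  "Aut P = GL2Z\<lparr>carrier := {A \<in> carrier GL2Z. act A ` P = P}\<rparr>"

definition reflection :: "int^2^2 \<Rightarrow> bool" where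
  "reflection A \<longleftrightarrow> A \<in> carrier GL2Z \<and> group.ord GL2Z A = 2 \<and> det A = -1"

definition unimodularly_equivalent :: "(real^2) set \<Rightarrow> (real^2) set \<Rightarrow> bool" where
  "unimodularly_equivalent P Q \<longleftrightarrow> (\<exists>A \<in> carrier GL2Z. act A ` P = Q)"

definition fixed_points :: "(real^2) set \<Rightarrow> (real^2) set" where
  "fixed_points P = {x. \<forall>A \<in> carrier (Aut P). act A x = x}"

definition symmetric :: "(real^2) set \<Rightarrow> bool" where
  "symmetric P \<longleftrightarrow> fixed_points P = {0}"

definition lattice_symmetric :: "(real^2) set \<Rightarrow> bool" where
  "lattice_symmetric P \<longleftrightarrow> fixed_points P \<inter> (P \<inter> lattice) = {0}"

definition dual :: "(real^2) set \<Rightarrow> (real^2) set" where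
  "dual P = {w. \<forall>v\<in>P. w \<bullet> v \<ge> -1}"

definition barycenter :: "(real^2) set \<Rightarrow> real^2" where
  "barycenter S = integral S (\<lambda>x. x) /\<^sub>R measure lebesgue S"

definition kaehler_einstein :: "(real^2) set \<Rightarrow> bool" where
  "kaehler_einstein P \<longleftrightarrow> barycenter (dual P) = 0"

definition P_mn :: "int \<Rightarrow> int \<Rightarrow> (real^2) set" where
  "P_mn m n = convex hull
     {vector [of_int (m + 1), of_int (- m)], vector [of_int (- m), of_int (m + 1)],
      vector [of_int (- n - 1), of_int n], vector [of_int n, of_int (- n - 1)]}"

end

theory Submission
  imports Defs
begin

text \<open>
  Suppose that \<open>P\<close> is not symmetric, so that some nonzero vector is fixed by all automorphisms.
  An automorphism of determinant one fixing a nonzero vector is unipotent, and boundedness of \<open>P\<close>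
  makes it trivial (\<open>bounded_unipotent_trivial\<close>). Hence the group injects into the two signs via
  the determinant. It is not trivial, since then the vertices of \<open>P\<close> would be fixed lattice
  points; so it consists of the identity and one reflection \<open>R\<close>
  (\<open>not_symmetric_Aut\<close>). Conversely, a reflection has a nonzero fixed vector, which is then fixed
  by the group that it generates.

  Over the integers a reflection is conjugate either to the diagonal matrix with entries \<open>1, -1\<close>
  or to the swap of coordinates (\<open>reflection_normal_form\<close>). The main tool is that the midpoint of
  a vertex and its mirror image is a fixed point of \<open>P\<close>. In the diagonal case this midpoint is a
  lattice point, and a vertex with positive first coordinate yields a nonzero fixed lattice point of
  \<open>P\<close>, contrary to lattice symmetry. In the swap case the midpoint of a vertex
  \<open>(a, b)\<close> is \<open>(a + b) / 2\<close> times \<open>(1, 1)\<close>, so lattice symmetry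
  says \<open>\<bar>a + b\<bar> \<le> 1\<close> for all vertices. The vertices with
  \<open>a + b = 1\<close> and \<open>a + b = -1\<close> span some \<open>P_mn m n\<close> with
  \<open>m, n \<ge> 0\<close>. If \<open>m = n\<close>, then \<open>P\<close> would be centrally
  symmetric, although \<open>-I\<close> is not in the group. Otherwise the only other possible vertices,
  \<open>(1, -1)\<close> and \<open>(-1, 1)\<close>, already belong to \<open>P_mn m n\<close>
  (\<open>swap_invariant_fano_polygon\<close>).

  For the barycenter, let \<open>m > n\<close>. In terms of the pairings \<open>s\<close> and
  \<open>d\<close> with \<open>(1, 1)\<close> and \<open>(1, -1)\<close>, the dual of
  \<open>P_mn m n\<close> is the kite
  \<open>-2 + (2 m + 1) \<bar>d\<bar> \<le> s \<le> 2 - (2 n + 1) \<bar>d\<bar>\<close>. The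
  negatives of its points with \<open>s < 0\<close> all belong to it, while an open set of its points with
  \<open>s > 0\<close> have negatives outside. Therefore the integral of \<open>s\<close> over the kite is
  positive (\<open>barycenter_nonzero_if_lopsided\<close>).
\<close>

section \<open>Two-by-two integer matrices\<close>

lemma act_nth:
  "act A x $ 1 = of_int (A$1$1) * x$1 + of_int (A$1$2) * x$2"
  "act A x $ 2 = of_int (A$2$1) * x$1 + of_int (A$2$2) * x$2"
  by (simp_all add: act_def matrix_vector_mult_def sum_2)

lemma mult_nth_2:
  fixes A B :: "'a::semiring_1^2^2"
  shows "(A ** B) $ i $ j = A$i$1 * B$1$j + A$i$2 * B$2$j"
  by (simp add: matrix_matrix_mult_def sum_2)

lemma mat_eq_iff_2: "A = B \<longleftrightarrow> A$1$1 = B$1$1 \<and> A$1$2 = B$1$2 \<and> A$2$1 = B$2$1 \<and> A$2$2 = B$2$2"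
  for A B :: "'a^2^2"
  by (auto simp: vec_eq_iff forall_2)

lemma mat_nth_2 [simp]:
  "(mat 1 :: 'a::semiring_1^2^2) $ 1 $ 1 = 1" "(mat 1 :: 'a^2^2) $ 1 $ 2 = 0"
  "(mat 1 :: 'a^2^2) $ 2 $ 1 = 0" "(mat 1 :: 'a^2^2) $ 2 $ 2 = 1"
  by (simp_all add: mat_def)

lemma linear_act: "linear (act A)"
  unfolding act_def by (rule matrix_vector_mul_linear)

lemma act_one [simp]: "act (mat 1) x = x"
  by (simp add: vec_eq_iff forall_2 act_nth)

lemma act_mult: "act (A ** B) x = act A (act B x)"
  by (simp add: vec_eq_iff forall_2 act_nth mult_nth_2 algebra_simps)

lemma carrier_GL2Z: "A \<in> carrier GL2Z \<longleftrightarrow> (\<exists>B. A ** B = mat 1 \<and> B ** A = mat 1)"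
  by (simp add: GL2Z_def invertible_def)

lemma GL2Z_simps [simp]: "x \<otimes>\<^bsub>GL2Z\<^esub> y = x ** y" "\<one>\<^bsub>GL2Z\<^esub> = mat 1"
  by (simp_all add: GL2Z_def)

lemma GL2Z_obtain_inverse:
  assumes "A \<in> carrier GL2Z"
  obtains B where "B \<in> carrier GL2Z" "A ** B = mat 1" "B ** A = mat 1"
    "\<And>x. act A (act B x) = x" "\<And>x. act B (act A x) = x"
  using assms by (metis carrier_GL2Z act_mult act_one)

lemma det_GL2Z: assumes "A \<in> carrier GL2Z" shows "det A = 1 \<or> det A = -1"
proof -
  obtain B where "A ** B = mat 1" using assms carrier_GL2Z by auto
  then have "det A * det B = 1" by (metis det_mul det_I)
  then show ?thesis by (simp add: zmult_eq_1_iff) blast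
qed

lemma GL2Z_I:
  assumes "det A = 1 \<or> det A = -1"
  shows "A \<in> carrier GL2Z"
proof -
  obtain s where s: "s = 1 \<or> s = -1" and d: "det A = s" using assms by auto
  define B :: "int^2^2" where
    "B = vector [vector [s * A$2$2, - s * A$1$2], vector [- s * A$2$1, s * A$1$1]]"
  have "A ** B = mat 1" "B ** A = mat 1"
    using s d by (auto simp: B_def mat_eq_iff_2 mult_nth_2 det_2 algebra_simps)
  then show ?thesis by (auto simp: carrier_GL2Z)
qed

lemma GL2Z_mult_closed: "A \<in> carrier GL2Z \<Longrightarrow> B \<in> carrier GL2Z \<Longrightarrow> A ** B \<in> carrier GL2Z"
  using group_GL2Z[THEN group.is_monoid, THEN monoid.m_closed, of A B] by simp

lemma bij_act: "A \<in> carrier GL2Z \<Longrightarrow> bij (act A)"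
  by (rule GL2Z_obtain_inverse[of A]) (auto intro!: o_bij simp: fun_eq_iff)

lemma carrier_Aut: "A \<in> carrier (Aut P) \<longleftrightarrow> A \<in> carrier GL2Z \<and> act A ` P = P"
  by (simp add: Aut_def)

lemma Aut_simps [simp]: "x \<otimes>\<^bsub>Aut P\<^esub> y = x ** y" "\<one>\<^bsub>Aut P\<^esub> = mat 1"
  by (simp_all add: Aut_def)

lemma Aut_mult_closed: "A \<in> carrier (Aut P) \<Longrightarrow> B \<in> carrier (Aut P) \<Longrightarrow> A ** B \<in> carrier (Aut P)"
  by (auto simp: carrier_Aut GL2Z_mult_closed act_mult image_image[symmetric])

lemma one_Aut: "mat 1 \<in> carrier (Aut P)"
  by (simp add: carrier_Aut GL2Z_I)

lemma group_Aut: "group (Aut P)"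
proof (rule groupI)
  fix A assume A: "A \<in> carrier (Aut P)"
  then obtain B where B: "B \<in> carrier GL2Z" "B ** A = mat 1" "\<And>x. act B (act A x) = x"
    by (metis GL2Z_obtain_inverse carrier_Aut)
  have "act B ` P = act B ` act A ` P" using A by (simp add: carrier_Aut)
  also have "\<dots> = P" by (simp add: image_image B)
  finally show "\<exists>B\<in>carrier (Aut P). B \<otimes>\<^bsub>Aut P\<^esub> A = \<one>\<^bsub>Aut P\<^esub>"
    using B by (auto simp: carrier_Aut)
qed (auto simp: Aut_mult_closed one_Aut matrix_mul_assoc)

section \<open>Integer matrices with a fixed vector\<close>

text \<open>
  One is an eigenvalue, so the characteristic polynomial \<open>z\<^sup>2 - (tr A) z + det A\<close>
  vanishes at one.
\<close>

lemma fixed_vector_determinant: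
  assumes "act A x = x" "x \<noteq> 0"
  shows "A$1$1 + A$2$2 = 1 + det A"
proof -
  let ?a = "real_of_int (A$1$1) - 1" and ?b = "real_of_int (A$1$2)"
  let ?c = "real_of_int (A$2$1)" and ?d = "real_of_int (A$2$2) - 1"
  have 1: "?a * x$1 + ?b * x$2 = 0" and 2: "?c * x$1 + ?d * x$2 = 0"
    using assms(1) by (auto simp: vec_eq_iff forall_2 act_nth algebra_simps)
  have "(?a * ?d - ?b * ?c) * x$1 = ?d * (?a * x$1 + ?b * x$2) - ?b * (?c * x$1 + ?d * x$2)"
       "(?a * ?d - ?b * ?c) * x$2 = ?a * (?c * x$1 + ?d * x$2) - ?c * (?a * x$1 + ?b * x$2)"
    by (simp_all add: algebra_simps)
  with 1 2 have "(?a * ?d - ?b * ?c) * x$1 = 0" "(?a * ?d - ?b * ?c) * x$2 = 0" by simp_all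
  moreover have "x$1 \<noteq> 0 \<or> x$2 \<noteq> 0" using assms(2) by (simp add: vec_eq_iff forall_2)
  ultimately have "?a * ?d - ?b * ?c = 0" by auto
  then have "real_of_int (A$1$1 + A$2$2) = real_of_int (1 + det A)"
    by (simp add: det_2 algebra_simps)
  then show ?thesis by (simp only: of_int_eq_iff)
qed

text \<open>
  Cayley--Hamilton: \<open>A\<^sup>2 = (tr A) A - (det A) I\<close>.
\<close>

lemma reflection_square:
  fixes A :: "int^2^2"
  assumes "det A = -1" "A$1$1 + A$2$2 = 0"
  shows "A ** A = mat 1"
proof -
  have d: "A$2$2 = - A$1$1" using assms(2) by simp
  show ?thesis using assms(1) unfolding mat_eq_iff_2 mult_nth_2 det_2 d
    by (simp add: algebra_simps)
qed

text \<open>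
  Cayley--Hamilton turns \<open>A\<^sup>2 = I\<close> into \<open>(tr A) A = 0\<close>; a nonzero trace
  would force \<open>A = 0\<close>.
\<close>

lemma reflection_trace:
  fixes A :: "int^2^2"
  assumes "det A = -1" "A ** A = mat 1"
  shows "A$1$1 + A$2$2 = 0"
proof (rule ccontr)
  let ?t = "A$1$1 + A$2$2"
  assume t: "?t \<noteq> 0"
  have "?t * A$1$1 = (A ** A)$1$1 - 1" "?t * A$2$2 = (A ** A)$2$2 - 1"
     "?t * A$1$2 = (A ** A)$1$2"
    using assms(1) by (simp_all add: mult_nth_2 det_2 algebra_simps)
  then have "A$1$1 = 0" "A$2$2 = 0" using t unfolding assms(2) by auto
  with t show False by simp
qed

text \<open>
  The trace is two, so \<open>N = A - I\<close> satisfies \<open>N\<^sup>2 = 0\<close>. The orbit of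
  \<open>v\<close> then contains all \<open>v + k N v\<close>, which in a bounded set forces
  \<open>N v = 0\<close>.
\<close>

lemma bounded_unipotent_trivial:
  assumes P: "bounded P" "0 \<in> interior P"
    and A: "act A ` P = P" "det A = 1" "act A x = x" "x \<noteq> 0"
  shows "A = mat 1"
proof -
  define N where "N v = act A v - v" for v
  have tr: "A$1$1 + A$2$2 = 2" using fixed_vector_determinant[OF A(3,4)] A(2) by simp
  have d: "real_of_int (A$2$2) = 2 - real_of_int (A$1$1)" using tr by simp
  have "A$1$1 * (2 - A$1$1) - A$1$2 * A$2$1 = 1"
  proof -
    have "A$2$2 = 2 - A$1$1" using tr by simp
    then show ?thesis using A(2) unfolding det_2 by simp
  qed
  then have e: "real_of_int (A$1$2) * real_of_int (A$2$1) = real_of_int (A$1$1) * (2 - real_of_int (A$1$1)) - 1"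
    by (smt (verit) of_int_1 of_int_diff of_int_mult of_int_numeral)
  have NN: "N (act A v) = N v" for v
  proof -
    define a b c where "a = real_of_int (A$1$1)" "b = real_of_int (A$1$2)" "c = real_of_int (A$2$1)"
    note abc = this[symmetric]
    have e': "b * c = a * (2 - a) - 1" and d': "real_of_int (A$2$2) = 2 - a"
      using e d by (simp_all add: abc)
    have "N (act A v) $ 1 - N v $ 1 = (b * c - (a * (2 - a) - 1)) * v$1"
         "N (act A v) $ 2 - N v $ 2 = (b * c - (a * (2 - a) - 1)) * v$2"
      unfolding N_def vector_minus_component act_nth abc d' by (simp_all add: algebra_simps)
    then show ?thesis by (simp add: e' vec_eq_iff forall_2)
  qed
  have iter: "v + real k *\<^sub>R N v \<in> P" if "v \<in> P" for v k
    using that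
  proof (induction k arbitrary: v)
    case (Suc k)
    have "act A v + real k *\<^sub>R N (act A v) \<in> P" using Suc A(1) by blast
    also have "act A v + real k *\<^sub>R N (act A v) = v + real (Suc k) *\<^sub>R N v"
      unfolding NN by (simp add: N_def algebra_simps)
    finally show ?case .
  qed simp
  have N0: "N v = 0" if v: "v \<in> P" for v
  proof (rule ccontr)
    assume n: "N v \<noteq> 0"
    obtain b where b: "\<And>y. y \<in> P \<Longrightarrow> norm y \<le> b" using P(1) bounded_iff by blast
    obtain k :: nat where k: "real k * norm (N v) > 2 * b" using n by (metis ex_less_of_nat_mult zero_less_norm_iff)
    have "real k * norm (N v) = norm ((v + real k *\<^sub>R N v) - v)" by simp
    also have "\<dots> \<le> 2 * b" using norm_triangle_ineq4[of "v + real k *\<^sub>R N v" v] b[OF v] b[OF iter[OF v, of k]] by linarith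
    finally show False using k by simp
  qed
  obtain e where e: "e > 0" "ball 0 e \<subseteq> P" using P(2) mem_interior by blast
  have "N ((e/2) *\<^sub>R axis i 1) = 0" for i
    using e N0[of "(e/2) *\<^sub>R axis i 1"] by (auto simp: subset_iff)
  from this[of 1] this[of 2] e(1) show ?thesis
    by (simp add: N_def vec_eq_iff forall_2 act_nth axis_def)
qed

lemma reflection_iff:
  "reflection A \<longleftrightarrow> A \<in> carrier GL2Z \<and> A ** A = mat 1 \<and> det A = -1"
proof -
  interpret group GL2Z by (rule group_GL2Z)
  have *: "A [^]\<^bsub>GL2Z\<^esub> (2::nat) = A ** A" if "A \<in> carrier GL2Z"
    using that by (simp add: numeral_2_eq_2)
  have "ord A = 2 \<longleftrightarrow> A ** A = mat 1" if A: "A \<in> carrier GL2Z" "det A = -1"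
  proof
    assume "ord A = 2"
    with pow_ord_eq_1[of A] * A show "A ** A = mat 1" by simp
  next
    assume "A ** A = mat 1"
    with * pow_eq_id[OF A(1), of 2] A have "ord A dvd 2" by simp
    moreover have "ord A \<noteq> 1"
      using ord_eq_1[OF A(1)] A(2) det_I[where ?'a = int and ?'n = 2] by auto
    ultimately show "ord A = 2" using prime_nat_iff two_is_prime_nat by blast
  qed
  then show ?thesis by (auto simp: reflection_def)
qed

section \<open>Groups generated by a reflection\<close>

lemma group_order_two_iso:
  assumes "group G" and G: "carrier G = {\<one>\<^bsub>G\<^esub>, r}" "r \<noteq> \<one>\<^bsub>G\<^esub>" "r \<otimes>\<^bsub>G\<^esub> r = \<one>\<^bsub>G\<^esub>"
  shows "G \<cong> integer_mod_group 2"
proof -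
  interpret group G by fact
  define h where "h x = (if x = \<one>\<^bsub>G\<^esub> then 0 else 1 :: int)" for x
  have "carrier (integer_mod_group 2) = {0, 1}"
    by (auto simp: carrier_integer_mod_group)
  then have "h \<in> iso G (integer_mod_group 2)"
    using G r_one[of r] l_one[of r] by (auto simp: iso_def hom_def bij_betw_def inj_on_def h_def)
  then show ?thesis by (auto simp: is_iso_def)
qed

lemma order_two_generate:
  assumes "group G" and G: "carrier G = {\<one>\<^bsub>G\<^esub>, r}"
  shows "carrier G = generate G {r}"
proof
  show "carrier G \<subseteq> generate G {r}"
    using G generate.one[of G] generate.incl[of r "{r}" G] by auto
  show "generate G {r} \<subseteq> carrier G"
    using group.generate_incl[OF assms(1)] G by auto
qed

text \<open>
  With trace zero and determinant minus one the matrix \<open>A - I\<close> is singular. A kernel vector is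
  read off from the first row of \<open>A - I\<close>, or from the second one if the first vanishes.
\<close>

lemma reflection_fixed_vector:
  assumes "det A = -1" "A$1$1 + A$2$2 = 0"
  obtains x where "x \<noteq> 0" "act A x = x"
proof -
  have d: "A$2$2 = - A$1$1" using assms(2) by simp
  then have "A$1$2 * A$2$1 = 1 - A$1$1 * A$1$1" using assms(1) by (simp add: det_2)
  then have e: "real_of_int (A$1$2) * real_of_int (A$2$1) = 1 - real_of_int (A$1$1) * real_of_int (A$1$1)"
    by (metis of_int_1 of_int_diff of_int_mult)
  show ?thesis
  proof (cases "A$1$2 = 0 \<and> A$1$1 = 1")
    case True
    show ?thesis
      by (rule that[of "vector [2, of_int (A$2$1)]"])
        (use True d in \<open>simp_all add: vec_eq_iff forall_2 act_nth\<close>)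
  next
    case False
    show ?thesis
      by (rule that[of "vector [of_int (A$1$2), 1 - of_int (A$1$1)]"])
        (use False d e in \<open>auto simp: vec_eq_iff forall_2 act_nth algebra_simps\<close>)
  qed
qed

text \<open>
  A fixed vector of the generator is fixed by the whole group.
\<close>

lemma reflection_group_not_symmetric:
  assumes "reflection R" "carrier (Aut P) = generate (Aut P) {R}"
  shows "\<not> symmetric P"
proof -
  have R: "R \<in> carrier GL2Z" "R ** R = mat 1" "det R = -1" using assms(1) by (auto simp: reflection_iff)
  obtain x where x: "x \<noteq> 0" "act R x = x"
    using reflection_fixed_vector[OF R(3) reflection_trace[OF R(3,2)]] by blast
  have RA: "R \<in> carrier (Aut P)" using assms(2) generate.incl[of R "{R}"] by auto
  have inv: "inv\<^bsub>Aut P\<^esub> R = R"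
    using group.inv_equality[OF group_Aut[of P], of R R] RA R(2) by simp
  have "act A x = x" if "A \<in> generate (Aut P) {R}" for A
    using that by induction (auto simp: x inv act_mult)
  then have "x \<in> fixed_points P" using assms(2) by (simp add: fixed_points_def)
  with x(1) show ?thesis by (auto simp: symmetric_def)
qed

section \<open>Vertices and automorphisms of Fano polygons\<close>

lemma polygon_hull_extreme:
  fixes P :: "(real^2) set"
  assumes "polytope P"
  shows "P = convex hull {v. v extreme_point_of P}"
  using Krein_Milman_Minkowski polytope_imp_compact polytope_imp_convex assms by blast

lemma fano_polygonD:
  assumes "fano_polygon P"
  shows "polytope P" "convex P" "compact P" "bounded P" "0 \<in> interior P" "0 \<in> P"
    "P = convex hull {v. v extreme_point_of P}"
  using assms polytope_imp_compact polytope_imp_convex polytope_imp_bounded polygon_hull_extreme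
    interior_subset[of P]
  by (auto simp: fano_polygon_def)

lemma fano_polygon_vertex:
  assumes "fano_polygon P" "v extreme_point_of P"
  obtains a b :: int where "coprime a b" "v = vector [of_int a, of_int b]"
  using assms by (auto simp: fano_polygon_def primitive_point_def)

text \<open>
  As the origin is an interior point, \<open>P\<close> has points of either sign for every nonzero linear
  functional; the hull of vertices with nonpositive values would lie in a half plane.
\<close>

lemma fano_polygon_vertex_positive:
  fixes c :: "real^2"
  assumes "fano_polygon P" "c \<noteq> 0"
  obtains v where "v extreme_point_of P" "c \<bullet> v > 0"
proof (rule ccontr)
  assume "\<not> thesis"
  with that have "{v. v extreme_point_of P} \<subseteq> {x. c \<bullet> x \<le> 0}" by force
  then have "P \<subseteq> {x. c \<bullet> x \<le> 0}"
    using fano_polygonD(7)[OF assms(1)] subset_hull[of convex] convex_halfspace_le by metis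
  moreover obtain e where "e > 0" "ball 0 e \<subseteq> P" using fano_polygonD(5)[OF assms(1)] mem_interior by blast
  then have "(e / (2 * norm c)) *\<^sub>R c \<in> P" using assms(2) by (auto simp: subset_iff)
  ultimately have "(e / (2 * norm c)) * (c \<bullet> c) \<le> 0" by auto
  moreover have "(e / (2 * norm c)) * (c \<bullet> c) > 0"
    using \<open>e > 0\<close> assms(2) by (intro mult_pos_pos) auto
  ultimately show False by linarith
qed

lemma vertex_in_lattice:
  assumes "fano_polygon P" "v extreme_point_of P"
  shows "v \<in> P" "v \<in> lattice" "v \<noteq> 0"
proof -
  obtain a b :: int where v: "coprime a b" "v = vector [of_int a, of_int b]"
    using fano_polygon_vertex[OF assms] .
  show "v \<in> P" using assms(2) by (simp add: extreme_point_of_def)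
  show "v \<in> lattice" using v by (simp add: lattice_def forall_2)
  show "v \<noteq> 0" using v by (auto simp: vec_eq_iff forall_2)
qed

text \<open>
  All automorphisms fix a common vector \<open>x\<close>. Those of determinant one are trivial by boundedness,
  and a product of two of determinant minus one has determinant one. Hence at most one nontrivial element
  exists; one does exist, since otherwise the vertices would be fixed lattice points of \<open>P\<close>.
\<close>

lemma not_symmetric_Aut:
  assumes P: "fano_polygon P" "lattice_symmetric P" and "\<not> symmetric P"
  obtains R where "R \<in> carrier GL2Z" "det R = -1" "R$1$1 + R$2$2 = 0" "carrier (Aut P) = {mat 1, R}"
proof -
  note PD = fano_polygonD[OF P(1)]
  have "0 \<in> fixed_points P" by (simp add: fixed_points_def linear_0[OF linear_act])
  then obtain x where x: "x \<in> fixed_points P" "x \<noteq> 0" using assms(3) by (auto simp: symmetric_def)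
  have one: "A = mat 1" if "A \<in> carrier (Aut P)" "det A = 1" for A
    using bounded_unipotent_trivial[OF PD(4,5) _ _ _ x(2)] that x(1)
    by (auto simp: carrier_Aut fixed_points_def)
  have "carrier (Aut P) \<noteq> {mat 1}"
  proof
    assume triv: "carrier (Aut P) = {mat 1}"
    obtain v where v: "v extreme_point_of P"
      using fano_polygon_vertex_positive[OF P(1) x(2)] by blast
    have "v \<in> fixed_points P" using triv by (simp add: fixed_points_def)
    then show False using P(2) vertex_in_lattice[OF P(1) v] by (auto simp: lattice_symmetric_def)
  qed
  then obtain R where R: "R \<in> carrier (Aut P)" "R \<noteq> mat 1" using one_Aut by blast
  have dR: "det A = -1" if "A \<in> carrier (Aut P)" "A \<noteq> mat 1" for A
    using that one det_GL2Z by (auto simp: carrier_Aut)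
  have tr: "R$1$1 + R$2$2 = 0"
    using fixed_vector_determinant[of R x] dR[OF R] x R by (simp add: fixed_points_def)
  have RR: "R ** R = mat 1" using reflection_square[OF dR[OF R] tr] .
  have "A = R" if A: "A \<in> carrier (Aut P)" "A \<noteq> mat 1" for A
  proof -
    have "A ** R = mat 1" using one[OF Aut_mult_closed[OF A(1) R(1)]] dR[OF A] dR[OF R] by (simp add: det_mul)
    then show ?thesis using RR by (metis matrix_mul_assoc matrix_mul_lid matrix_mul_rid)
  qed
  then have "carrier (Aut P) = {mat 1, R}" using R one_Aut by blast
  then show ?thesis using that[of R] R(1) dR[OF R] tr unfolding carrier_Aut by blast
qed

section \<open>Conjugacy classes of reflections\<close>

abbreviation diag_matrix :: "int^2^2" where
  "diag_matrix \<equiv> vector [vector [1, 0], vector [0, -1]]"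

abbreviation swap_matrix :: "int^2^2" where
  "swap_matrix \<equiv> vector [vector [0, 1], vector [1, 0]]"

text \<open>
  Over the integers there are exactly two conjugacy classes of reflections; the reflection with respect to a
  coordinate axis and the coordinate swap are conjugate over the reals but not here. The proof completes a
  primitive fixed vector \<open>u\<close> to a lattice basis \<open>(u, w)\<close>. The determinant forces
  \<open>R w = k u - w\<close>, and replacing \<open>w\<close> by \<open>w + j u\<close> changes
  \<open>k\<close> to \<open>k + 2 j\<close>, so only the parity of \<open>k\<close> matters. For
  \<open>k = 0\<close> the basis \<open>(u, w)\<close> diagonalises \<open>R\<close>; for
  \<open>k = 1\<close> the vectors \<open>w\<close> and \<open>u - w\<close> are exchanged.
\<close>

lemma reflection_normal_form:
  fixes R :: "int^2^2"
  assumes R: "det R = -1" "R$1$1 + R$2$2 = 0"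
  obtains B where "B \<in> carrier GL2Z"
    "R ** B = B ** diag_matrix \<or> R ** B = B ** swap_matrix"
proof -
  define a b c where "a = R$1$1" "b = R$1$2" "c = R$2$1"
  note abc = this
  have d: "R$2$2 = - a" using R(2) by (simp add: abc)
  have abc1: "a * a + b * c = 1" using R(1) d by (simp add: det_2 abc algebra_simps)
  obtain x y :: int where xy: "(x, y) \<noteq> (0, 0)" "a * x + b * y = x" "c * x - a * y = y"
  proof (cases "b = 0 \<and> a = 1")
    case True
    show ?thesis by (rule that[of 2 c]) (use True in auto)
  next
    case False
    show ?thesis by (rule that[of b "1 - a"]) (use False abc1 in \<open>auto simp: algebra_simps\<close>)
  qed
  define g where "g = gcd x y"
  have g: "g \<noteq> 0" using xy(1) by (auto simp: g_def)
  define u v where "u = x div g" "v = y div g"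
  note uv = this
  have xg: "x = g * u" "y = g * v" by (simp_all add: uv g_def)
  have "coprime u v" using g xy(1) unfolding uv g_def by (auto intro: div_gcd_coprime)
  then obtain s t where st: "s * u + t * v = 1" by (metis bezout_int coprime_iff_gcd_eq_1)
  have "g * (a * u + b * v) = g * u" "g * (c * u - a * v) = g * v"
    using xy(2,3) unfolding xg by (simp_all add: algebra_simps)
  then have fixu: "a * u + b * v = u" "c * u - a * v = v" using g by simp_all
  \<comment> \<open>The vector \<open>(-t, s)\<close> completes \<open>(u, v)\<close> to a basis. As \<open>k\<close> take the determinant of
    its image and itself, which is the coefficient of \<open>(u, v)\<close> in the image.\<close>
  define k where "k = s * (-a * t + b * s) + t * (-c * t - a * s)"
  have Rq: "- a * t + b * s = k * u + t" "- c * t - a * s = k * v - s"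
  proof -
    define X Y where "X = - a * t + b * s" "Y = - c * t - a * s"
    note XY = this
    have "u * Y - v * X = - t * (c * u - a * v) - s * (a * u + b * v)"
      unfolding XY by (simp add: algebra_simps)
    then have w: "u * Y - v * X = - 1" using st unfolding fixu by (simp add: algebra_simps)
    have "X * (s * u + t * v) = u * (s * X + t * Y) - t * (u * Y - v * X)"
         "Y * (s * u + t * v) = v * (s * X + t * Y) + s * (u * Y - v * X)"
      by (simp_all add: algebra_simps)
    then have "X = k * u + t" "Y = k * v - s" unfolding st w by (simp_all add: k_def XY mult.commute)
    then show "- a * t + b * s = k * u + t" "- c * t - a * s = k * v - s" by (simp_all add: XY)
  qed
  define j where "j = - (k div 2)"
  \<comment> \<open>With this shift the new coefficient \<open>k + 2 * j\<close> is \<open>k mod 2\<close>.\<close>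
  define p q where "p = - t + j * u" "q = s + j * v"
  note pq = this
  have det: "u * q - v * p = 1" using st unfolding pq by (simp add: algebra_simps)
  have "a * p + b * q = (- a * t + b * s) + j * (a * u + b * v)"
       "c * p - a * q = (- c * t - a * s) + j * (c * u - a * v)"
    unfolding pq by (simp_all add: algebra_simps)
  then have Rpq: "a * p + b * q = (k + 2 * j) * u - p" "c * p - a * q = (k + 2 * j) * v - q"
    unfolding Rq fixu by (simp_all add: pq algebra_simps)
  have "k + 2 * j = 0 \<or> k + 2 * j = 1" unfolding j_def by presburger
  then consider "k + 2 * j = 0" | "k + 2 * j = 1" by blast
  then show ?thesis
  proof cases
    case 1
    define B :: "int^2^2" where "B = vector [vector [u, p], vector [v, q]]"
    have "B \<in> carrier GL2Z" using det by (intro GL2Z_I) (simp add: B_def det_2 algebra_simps)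
    moreover have "R ** B = B ** diag_matrix"
      using Rpq fixu unfolding 1 by (simp add: B_def mat_eq_iff_2 mult_nth_2 d flip: abc)
    ultimately show ?thesis using that by blast
  next
    case 2
    define B :: "int^2^2" where "B = vector [vector [p, u - p], vector [q, v - q]]"
    have "B \<in> carrier GL2Z" using det by (intro GL2Z_I) (simp add: B_def det_2 algebra_simps)
    moreover have "R ** B = B ** swap_matrix"
      using Rpq fixu unfolding 2 by (simp add: B_def mat_eq_iff_2 mult_nth_2 d algebra_simps flip: abc)
    ultimately show ?thesis using that by blast
  qed
qed

section \<open>Unimodular images of Fano polygons\<close>

text \<open>
  By Cramer's rule a common divisor of the image coordinates divides \<open>det A\<close> times the original
  ones.
\<close>

lemma coprime_act:
  assumes "A \<in> carrier GL2Z" "coprime a b"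
  shows "coprime (A$1$1 * a + A$1$2 * b) (A$2$1 * a + A$2$2 * b)"
proof (rule coprimeI)
  fix d assume d: "d dvd A$1$1 * a + A$1$2 * b" "d dvd A$2$1 * a + A$2$2 * b"
  have "A$2$2 * (A$1$1 * a + A$1$2 * b) - A$1$2 * (A$2$1 * a + A$2$2 * b) = det A * a"
    "A$1$1 * (A$2$1 * a + A$2$2 * b) - A$2$1 * (A$1$1 * a + A$1$2 * b) = det A * b"
    by (simp_all add: det_2 algebra_simps)
  with d have "d dvd det A * a" "d dvd det A * b" by (metis dvd_diff dvd_mult)+
  then have "d dvd a" "d dvd b" using det_GL2Z[OF assms(1)] by auto
  then show "is_unit d" using assms(2) coprime_common_divisor by blast
qed

lemma primitive_point_act:
  assumes "A \<in> carrier GL2Z" "primitive_point x"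
  shows "primitive_point (act A x)"
proof -
  obtain a b where ab: "coprime a b" "x = vector [of_int a, of_int b]" using assms(2) by (auto simp: primitive_point_def)
  have "act A x = vector [of_int (A$1$1 * a + A$1$2 * b), of_int (A$2$1 * a + A$2$2 * b)]"
    by (simp add: ab vec_eq_iff forall_2 act_nth)
  then show ?thesis using coprime_act[OF assms(1) ab(1)] unfolding primitive_point_def by blast
qed

lemma fano_polygon_act:
  assumes "A \<in> carrier GL2Z" "fano_polygon P"
  shows "fano_polygon (act A ` P)"
proof -
  have inj: "inj (act A)" using bij_act[OF assms(1)] bij_is_inj by blast
  have "primitive_point w" if w: "w extreme_point_of (act A ` P)" for w
  proof -
    obtain v where v: "w = act A v" "v \<in> P" using w by (auto simp: extreme_point_of_def)
    have "act A ` {v} face_of act A ` P" using w v by (simp add: face_of_singleton)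
    then have "v extreme_point_of P"
      using face_of_linear_image[OF linear_act inj] by (simp only: face_of_singleton)
    then show ?thesis using assms primitive_point_act v by (auto simp: fano_polygon_def)
  qed
  moreover have "0 \<in> interior (act A ` P)"
    using assms(2) linear_0[OF linear_act[of A]]
    by (auto simp: interior_injective_linear_image[OF linear_act inj] fano_polygon_def image_iff intro!: bexI[of _ 0])
  ultimately show ?thesis
    using assms(2) polytope_linear_image[OF linear_act] aff_dim_injective_linear_image[OF linear_act inj]
    by (auto simp: fano_polygon_def)
qed

section \<open>Fano polygons invariant under a reflection in normal form\<close>

lemma convex_scaled_mem:
  assumes "convex S" "0 \<in> S" "x \<in> S" "x = c *\<^sub>R y" "c \<ge> (1::real)"
  shows "y \<in> S"
proof -
  have "(1 - 1/c) *\<^sub>R 0 + (1/c) *\<^sub>R x \<in> S"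
    by (rule convexD[OF assms(1-3)]) (use assms(5) in auto)
  then show ?thesis using assms(4,5) by simp
qed

lemma convex_midpoint_mem: 
  assumes "convex S" "x \<in> S" "y \<in> S" 
  shows "midpoint x y \<in> S"
  using convexD[OF assms, of "1/2" "1/2"] by (simp add: midpoint_def algebra_simps)

text \<open>
  The midpoint of a vertex \<open>(a, b)\<close> with \<open>a > 0\<close> and its mirror image
  \<open>(a, -b)\<close> is the fixed lattice point \<open>(a, 0)\<close>, and shrinking it towards the
  origin gives \<open>(1, 0)\<close>. This is what excludes the diagonal normal form for polygons without
  nonzero fixed lattice points.
\<close>

lemma fano_diagonal_reflection_fixes_lattice_point:
  assumes Q: "fano_polygon Q" and R: "act diag_matrix ` Q = Q"
  shows "vector [1, 0] \<in> Q"
proof -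
  obtain v where v: "v extreme_point_of Q" "axis 1 1 \<bullet> v > 0"
    using fano_polygon_vertex_positive[OF Q, of "axis 1 1"] by (auto simp: axis_eq_0_iff)
  obtain a b :: int where ab: "v = vector [of_int a, of_int b]" using fano_polygon_vertex[OF Q v(1)] by metis
  have a: "a \<ge> 1" using v(2) by (simp add: ab inner_vec_def sum_2 axis_def)
  have vQ: "v \<in> Q" using vertex_in_lattice[OF Q v(1)] by simp
  then have "midpoint v (act diag_matrix v) \<in> Q"
    using R fano_polygonD(2)[OF Q] by (intro convex_midpoint_mem) auto
  then show ?thesis
    by (rule convex_scaled_mem[OF fano_polygonD(2)[OF Q] fano_polygonD(6)[OF Q], of _ "of_int a"])
      (use a in \<open>simp_all add: ab vec_eq_iff forall_2 midpoint_def act_nth\<close>)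
qed

lemma segment_symmetric_points:
  fixes S :: "(real^2) set" and c k a :: int
  assumes S: "convex S" "vector [of_int k, of_int (c - k)] \<in> S" "vector [of_int (c - k), of_int k] \<in> S"
    and "a \<le> k" "c - a \<le> k"
  shows "vector [of_int a, of_int (c - a)] \<in> S"
proof (cases "2 * k = c")
  case True
  then have "a = k" using assms(4,5) by linarith
  then show ?thesis using S by simp
next
  case False
  have pos: "real_of_int (2 * k - c) > 0" using assms(4,5) False by linarith
  define l where "l = real_of_int (a - (c - k)) / real_of_int (2 * k - c)"
  have l: "l * (2 * real_of_int k - real_of_int c) = real_of_int a - (real_of_int c - real_of_int k)"
    using pos by (simp add: l_def)
  have "0 \<le> l" "l \<le> 1" using pos assms(4,5) by (simp_all add: l_def)
  then have "l *\<^sub>R vector [of_int k, of_int (c - k)] + (1 - l) *\<^sub>R vector [of_int (c - k), of_int k] \<in> S"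
    by (intro convexD[OF S(1-3)]) auto
  also have "l *\<^sub>R vector [of_int k, of_int (c - k)] + (1 - l) *\<^sub>R vector [of_int (c - k), of_int k] 
     = (vector [of_int a, of_int (c - a)] :: real^2)"
    using l by (simp add: vec_eq_iff forall_2 algebra_simps)
  finally show ?thesis .
qed

lemma act_swap_matrix: "act swap_matrix (vector [x, y]) = vector [y, x]"
  by (simp add: vec_eq_iff forall_2 act_nth)

text \<open>
  Coordinates on the line \<open>x + y = c\<close>. Asking for both a point and its image under the
  coordinate swap makes \<open>k\<close> bound both coordinates of every other such point.
\<close>

lemma farthest_lattice_point_on_line:
  fixes Q :: "(real^2) set" and c :: int
  assumes "bounded Q" "vector [of_int a, of_int (c - a)] \<in> Q" "vector [of_int (c - a), of_int a] \<in> Q"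
  obtains k where "vector [of_int k, of_int (c - k)] \<in> Q" "vector [of_int (c - k), of_int k] \<in> Q"
    "\<And>b. vector [of_int b, of_int (c - b)] \<in> Q \<Longrightarrow> vector [of_int (c - b), of_int b] \<in> Q \<Longrightarrow> b \<le> k \<and> c - b \<le> k"
proof -
  define K where "K = {b. vector [of_int b, of_int (c - b)] \<in> Q \<and> vector [of_int (c - b), of_int b] \<in> Q}"
  obtain B where B: "\<And>x. x \<in> Q \<Longrightarrow> norm x \<le> B" using assms(1) bounded_iff by blast
  have "\<bar>b\<bar> \<le> \<lceil>B\<rceil>" if "b \<in> K" for b
  proof -
    have "\<bar>real_of_int b\<bar> \<le> B"
      using that B[of "vector [of_int b, of_int (c - b)]"] component_le_norm_cart[of "vector [of_int b, of_int (c - b)] :: real^2" 1]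
      by (auto simp: K_def)
    then show ?thesis by linarith
  qed
  then have "K \<subseteq> {- \<lceil>B\<rceil>..\<lceil>B\<rceil>}" by force
  then have fin: "finite K" using finite_subset by blast
  have ne: "K \<noteq> {}" using assms by (auto simp: K_def)
  have "Max K \<in> K" using fin ne by (rule Max_in)
  moreover have "b \<le> Max K \<and> c - b \<le> Max K" if "b \<in> K" for b
    using that by (intro conjI Max_ge[OF fin]) (auto simp: K_def)
  ultimately show ?thesis using that[of "Max K"] by (auto simp: K_def)
qed

text \<open>
  The midpoint of a vertex \<open>(a, b)\<close> and its mirror image is \<open>(a + b) / 2\<close> times
  \<open>(1, 1)\<close>. As \<open>(1, 1)\<close> and \<open>(-1, -1)\<close> are outside \<open>Q\<close>,
  the vertices lie on the three lines \<open>x + y = c\<close> with \<open>c\<close> in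
  \<open>{-1, 0, 1}\<close>. The outer two lines carry the edges of \<open>P_mn m n\<close>, where
  \<open>m\<close> and \<open>n\<close> are determined by the outermost lattice points. On the line
  \<open>c = 0\<close> only the primitive points \<open>(1, -1)\<close> and \<open>(-1, 1)\<close> can be
  vertices: if \<open>m = n\<close> they may be, but then \<open>Q\<close> is centrally symmetric; if
  \<open>m \<noteq> n\<close> they already lie in \<open>P_mn m n\<close>, which contains the origin and
  the multiples of these points by \<open>(m + n + 1) / 2 \<ge> 1\<close>.
\<close>

lemma swap_invariant_fano_polygon:
  assumes Q: "fano_polygon Q" and R: "act swap_matrix ` Q = Q"
    and u: "vector [1, 1] \<notin> Q" "vector [-1, -1] \<notin> Q" and asym: "uminus ` Q \<noteq> Q"
  obtains m n :: int where "m \<ge> 0" "n \<ge> 0" "m \<noteq> n" "Q = P_mn m n"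
proof -
  note QD = fano_polygonD[OF Q]
  have swap: "vector [y, x] \<in> Q" if "vector [x, y] \<in> Q" for x y
    using that R act_swap_matrix by (metis imageI)
  have height: "-1 \<le> a + b \<and> a + b \<le> 1" if "vector [of_int a, of_int b] \<in> Q" for a b :: int
  proof -
    have mid: "midpoint (vector [of_int a, of_int b]) (vector [of_int b, of_int a]) \<in> Q"
      using convex_midpoint_mem[OF QD(2)] that swap by blast
    have "\<not> a + b \<ge> 2"
    proof
      assume ab: "a + b \<ge> 2"
      have "vector [1, 1] \<in> Q"
        by (rule convex_scaled_mem[OF QD(2,6) mid, of "of_int (a + b) / 2"])
          (use ab in \<open>simp_all add: vec_eq_iff forall_2 midpoint_def\<close>)
      with u show False by simp
    qed
    moreover have "\<not> a + b \<le> -2"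
    proof
      assume ab: "a + b \<le> -2"
      have "vector [-1, -1] \<in> Q"
        by (rule convex_scaled_mem[OF QD(2,6) mid, of "of_int (- a - b) / 2"])
          (use ab in \<open>simp_all add: vec_eq_iff forall_2 midpoint_def\<close>)
      with u show False by simp
    qed
    ultimately show ?thesis by linarith
  qed
  have inner2: "(vector [x, y] :: real^2) \<bullet> vector [z, w] = x * z + y * w" for x y z w :: real
    by (simp add: inner_vec_def sum_2)
  obtain v where v: "v extreme_point_of Q" "vector [1, 1] \<bullet> v > 0"
    using fano_polygon_vertex_positive[OF Q, of "vector [1, 1]"] by (auto simp: vec_eq_iff forall_2)
  obtain a b where ab: "v = vector [real_of_int a, real_of_int b]" using fano_polygon_vertex[OF Q v(1)] by metis
  have "v \<in> Q" using vertex_in_lattice[OF Q v(1)] by simp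
  moreover have "a + b > 0" using v(2) by (simp add: ab inner2)
  ultimately have "b = 1 - a" using height ab by force
  then have a: "vector [of_int a, of_int (1 - a)] \<in> Q" "vector [of_int (1 - a), of_int a] \<in> Q"
    using \<open>v \<in> Q\<close> swap ab by auto
  obtain v' where v': "v' extreme_point_of Q" "vector [-1, -1] \<bullet> v' > 0"
    using fano_polygon_vertex_positive[OF Q, of "vector [-1, -1]"] by (auto simp: vec_eq_iff forall_2)
  obtain a' b' where ab': "v' = vector [real_of_int a', real_of_int b']" using fano_polygon_vertex[OF Q v'(1)] by metis
  have "v' \<in> Q" using vertex_in_lattice[OF Q v'(1)] by simp
  moreover have "a' + b' < 0" using v'(2) by (simp add: ab' inner2)
  ultimately have "b' = -1 - a'" using height ab' by force
  then have a': "vector [of_int a', of_int (-1 - a')] \<in> Q" "vector [of_int (-1 - a'), of_int a'] \<in> Q"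
    using \<open>v' \<in> Q\<close> swap ab' by auto
  obtain k where k: "vector [of_int k, of_int (1 - k)] \<in> Q" "vector [of_int (1 - k), of_int k] \<in> Q"
    "\<And>b. vector [of_int b, of_int (1 - b)] \<in> Q \<Longrightarrow> b \<le> k \<and> 1 - b \<le> k"
    using farthest_lattice_point_on_line[OF QD(4) a] swap by metis
  obtain n where n: "vector [of_int n, of_int (-1 - n)] \<in> Q" "vector [of_int (-1 - n), of_int n] \<in> Q"
    "\<And>b. vector [of_int b, of_int (-1 - b)] \<in> Q \<Longrightarrow> b \<le> n \<and> -1 - b \<le> n"
    using farthest_lattice_point_on_line[OF QD(4) a'] swap by metis
  \<comment> \<open>The extreme points on the upper line are \<open>(m + 1, -m)\<close> and its mirror image.\<close>
  define m where "m = k - 1"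
  have m0: "m \<ge> 0" using k(3)[OF k(1)] by (simp add: m_def)
  have n0: "n \<ge> 0" using n(3)[OF n(1)] by simp
  let ?P = "P_mn m n"
  have cP: "convex ?P" by (simp add: P_mn_def)
  have n': "- 1 - real_of_int n = - real_of_int n - 1" by simp
  have P4: "vector [of_int k, of_int (1 - k)] \<in> ?P" "vector [of_int (1 - k), of_int k] \<in> ?P"
    "vector [of_int n, of_int (-1 - n)] \<in> ?P" "vector [of_int (-1 - n), of_int n] \<in> ?P"
    unfolding P_mn_def by (auto simp: m_def n' intro!: hull_inc)
  have PQ: "?P \<subseteq> Q"
    unfolding P_mn_def
    by (rule hull_minimal) (use k n QD(2) in \<open>auto simp: m_def n'\<close>)
  have line1: "vector [of_int b, of_int (1 - b)] \<in> ?P" if "vector [of_int b, of_int (1 - b)] \<in> Q" for b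
    using segment_symmetric_points[OF cP, of k 1 b] P4 k(3)[OF that] by simp
  have line2: "vector [of_int b, of_int (-1 - b)] \<in> ?P" if "vector [of_int b, of_int (-1 - b)] \<in> Q" for b
    using segment_symmetric_points[OF cP, of n "-1" b] P4 n(3)[OF that] by simp
  have vertex_cases: "(\<exists>b. v = vector [of_int b, of_int (1 - b)] \<and> v \<in> Q) \<or> (\<exists>b. v = vector [of_int b, of_int (-1 - b)] \<and> v \<in> Q)
      \<or> v = vector [1, -1] \<or> v = vector [-1, 1]" if v: "v extreme_point_of Q" for v
  proof -
    obtain a b where ab: "coprime a b" "v = vector [real_of_int a, real_of_int b]" using fano_polygon_vertex[OF Q v] by metis
    have vQ: "v \<in> Q" using vertex_in_lattice[OF Q v] by simp
    then consider "b = 1 - a" | "b = -1 - a" | "b = - a" using height[of a b] ab(2) by force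
    then show ?thesis
    proof cases
      case 3
      then have "is_unit a" using ab(1) by (auto dest: coprime_common_divisor[of a "-a" a])
      then have "a = 1 \<or> a = -1" by (auto simp: abs_if split: if_splits)
      then show ?thesis using 3 ab(2) by auto
    qed (use vQ ab(2) in blast)+
  qed
  have "m \<noteq> n"
  proof
    assume mn: "m = n"
    have "- v \<in> Q" if v: "v extreme_point_of Q" for v
      using vertex_cases[OF v]
    proof (elim disjE exE conjE)
      fix b assume b: "v = vector [of_int b, of_int (1 - b)]" "v \<in> Q"
      have "vector [of_int (-b), of_int (-1 - (- b))] \<in> Q"
        using segment_symmetric_points[OF QD(2), of n "-1" "-b"] n k(3)[of b] b mn by (simp add: m_def)
      moreover have "- v = vector [of_int (-b), of_int (-1 - (- b))]" by (simp add: b vec_eq_iff forall_2)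
      ultimately show ?thesis by simp
    next
      fix b assume b: "v = vector [of_int b, of_int (-1 - b)]" "v \<in> Q"
      have "vector [of_int (-b), of_int (1 - (- b))] \<in> Q"
        using segment_symmetric_points[OF QD(2), of k "1" "-b"] k n(3)[of b] b mn by (simp add: m_def)
      moreover have "- v = vector [of_int (-b), of_int (1 - (- b))]" by (simp add: b vec_eq_iff forall_2)
      ultimately show ?thesis by simp
    next
      assume b: "v = vector [1, -1]"
      have "vector [-1, 1] \<in> Q" using swap vertex_in_lattice(1)[OF Q v] b by blast
      moreover have "- v = vector [-1, 1]" by (simp add: b vec_eq_iff forall_2)
      ultimately show ?thesis by simp
    next
      assume b: "v = vector [-1, 1]"
      have "vector [1, -1] \<in> Q" using swap vertex_in_lattice(1)[OF Q v] b by blast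
      moreover have "- v = vector [1, -1]" by (simp add: b vec_eq_iff forall_2)
      ultimately show ?thesis by simp
    qed
    then have "{v. v extreme_point_of Q} \<subseteq> uminus ` Q" by (force simp: image_iff)
    then have "convex hull {v. v extreme_point_of Q} \<subseteq> uminus ` Q"
      by (intro hull_minimal) (auto simp: convex_negations QD(2))
    then have "Q \<subseteq> uminus ` Q" using QD(7) by simp
    then have "uminus ` Q \<subseteq> uminus ` uminus ` Q" by (rule image_mono)
    then have "uminus ` Q \<subseteq> Q" by (simp add: image_image)
    with \<open>Q \<subseteq> uminus ` Q\<close> asym show False by auto
  qed
  have horiz: "vector [1, -1] \<in> ?P \<and> vector [-1, 1] \<in> ?P"
  proof -
    let ?t = "real_of_int (m + n + 1) / 2"
    have t: "?t \<ge> 1" using m0 n0 \<open>m \<noteq> n\<close> by simp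
    have *: "midpoint (vector [of_int k, of_int (1 - k)]) (vector [of_int n, of_int (-1 - n)]) \<in> ?P"
      "midpoint (vector [of_int (1 - k), of_int k]) (vector [of_int (-1 - n), of_int n]) \<in> ?P"
      using convex_midpoint_mem[OF cP] P4 by blast+
    have "midpoint (midpoint (vector [of_int k, of_int (1 - k)]) (vector [of_int n, of_int (-1 - n)]))
       (midpoint (vector [of_int (1 - k), of_int k]) (vector [of_int (-1 - n), of_int n])) \<in> ?P"
      using convex_midpoint_mem[OF cP *] .
    also have "midpoint (midpoint (vector [of_int k, of_int (1 - k)]) (vector [of_int n, of_int (-1 - n)]))
       (midpoint (vector [of_int (1 - k), of_int k]) (vector [of_int (-1 - n), of_int n])) = (0::real^2)"
      by (simp add: vec_eq_iff forall_2 midpoint_def) (simp flip: add_divide_distrib)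
    finally have 0: "0 \<in> ?P" .
    show ?thesis
      using convex_scaled_mem[OF cP 0 *(1), of ?t "vector [1, -1]"] convex_scaled_mem[OF cP 0 *(2), of ?t "vector [-1, 1]"] t
      by (simp add: vec_eq_iff forall_2 midpoint_def m_def algebra_simps)
  qed
  have "convex hull {v. v extreme_point_of Q} \<subseteq> ?P"
    by (rule hull_minimal) (use vertex_cases line1 line2 horiz cP in auto)
  then have "Q = ?P" using PQ QD(7) by auto
  then show ?thesis using that m0 n0 \<open>m \<noteq> n\<close> by blast
qed

section \<open>The barycenter of the dual polygon\<close>

text \<open>
  A ball of radius \<open>e\<close> around the origin inside \<open>P\<close> bounds the norms in the dual by
  a multiple of \<open>1 / e\<close>.
\<close>

lemma compact_dual:
  assumes "0 \<in> interior P"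
  shows "compact (dual P)"
proof -
  have "dual P = (\<Inter>v\<in>P. {w. v \<bullet> w \<ge> -1})" by (auto simp: dual_def inner_commute)
  then have "closed (dual P)" by (auto intro!: closed_INT closed_halfspace_ge)
  obtain e where e: "e > 0" "ball 0 e \<subseteq> P" using assms mem_interior by blast
  have "norm w \<le> 2 / e" if w: "w \<in> dual P" for w
  proof (cases "w = 0")
    case False
    have "- (e / (2 * norm w)) *\<^sub>R w \<in> P" using e False by (auto simp: subset_iff)
    then have "w \<bullet> (- (e / (2 * norm w)) *\<^sub>R w) \<ge> -1" using w by (auto simp: dual_def)
    then show ?thesis using e False by (simp add: field_simps dot_square_norm power2_eq_square)
  qed (use e in simp)
  then have "bounded (dual P)" unfolding bounded_iff by blast
  with \<open>closed (dual P)\<close> show ?thesis by (simp add: compact_eq_bounded_closed)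
qed

text \<open>
  The integral of \<open>f w = w \<bullet> u\<close> over \<open>D\<close> is positive, because pairing
  \<open>w\<close> with \<open>-w\<close> cancels the part of \<open>D\<close> with \<open>f < 0\<close>
  against part of the rest and leaves at least \<open>U\<close>. Formally, with \<open>g\<close> the extension
  of \<open>f\<close> by zero, \<open>h w = g w + g (-w)\<close> is nonnegative, equals
  \<open>f\<close> on \<open>U\<close>, and has twice the integral of \<open>f\<close>. This avoids computing
  any barycenter, and the hypotheses are stable under linear coordinate changes.
\<close>

lemma barycenter_nonzero_if_lopsided:
  fixes D U :: "(real^2) set"
  assumes D: "compact D" and U: "open U" "U \<noteq> {}" "U \<subseteq> D"
    and refl: "\<And>w. w \<in> D \<Longrightarrow> w \<bullet> u < 0 \<Longrightarrow> - w \<in> D"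
    and strict: "\<And>w. w \<in> U \<Longrightarrow> w \<bullet> u > 0 \<and> - w \<notin> D"
  shows "barycenter D \<noteq> 0"
proof
  assume bary: "barycenter D = 0"
  have "\<not> negligible D"
    using open_not_negligible[OF U(1,2)] negligible_subset[OF _ U(3)] by blast
  then have "measure lebesgue D \<noteq> 0"
    using lmeasurable_compact[OF D] by (simp add: negligible_iff_measure)
  then have J: "integral D (\<lambda>x. x) = 0" using bary by (simp add: barycenter_def)
  have "set_integrable lborel D (\<lambda>x. x)"
    unfolding set_integrable_def by (rule borel_integrable_compact[OF D]) simp
  then have "(\<lambda>x. x) integrable_on D" by (rule set_borel_integral_eq_integral(1))
  then have "((\<lambda>x. x) has_integral 0) D" using J integrable_integral by fastforce
  from has_integral_linear[OF this bounded_linear_inner_left[of u]]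
  have fD: "((\<lambda>w. w \<bullet> u) has_integral 0) D" by (simp add: o_def)
  obtain c where c: "D \<subseteq> cbox (-c) c" using compact_imp_bounded[OF D] bounded_subset_cbox_symmetric by blast
  define g where "g w = (if w \<in> D then w \<bullet> u else 0)" for w
  define h where "h w = g w + g (- w)" for w
  have g: "(g has_integral 0) (cbox (-c) c)"
    unfolding g_def using has_integral_restrict[OF c, of "\<lambda>w. w \<bullet> u" 0] fD by (rule iffD2)
  then have "((\<lambda>w. g (- w)) has_integral 0) (cbox (-c) c)"
    using has_integral_reflect[of g 0 c "-c"] by simp
  from has_integral_add[OF g this] have h: "(h has_integral 0) (cbox (-c) c)"
    by (simp add: h_def[abs_def])
  have h0: "h w \<ge> 0" for w
    using refl[of w] refl[of "-w"] by (auto simp: h_def g_def intro: leI)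
  obtain a b where ab: "cbox a b \<subseteq> U" "box a b \<noteq> {}"
    using U(1,2) open_contains_cbox by (metis all_not_in_conv)
  have hU: "h w = w \<bullet> u" if "w \<in> cbox a b" for w
    using that ab(1) U(3) strict by (auto simp: h_def g_def)
  have cont: "continuous_on (cbox a b) (\<lambda>w. w \<bullet> u)" by (intro continuous_intros)
  have "integral (cbox a b) (\<lambda>w. w \<bullet> u) = integral (cbox a b) h"
    by (rule integral_cong) (simp add: hU)
  also have "\<dots> \<le> integral (cbox (-c) c) h"
  proof (rule integral_subset_le)
    show "h integrable_on cbox a b"
      using integrable_continuous[OF cont] integrable_cong[of "cbox a b" h] hU by metis
  qed (use ab U(3) c h h0 in auto)
  finally have "integral (cbox a b) (\<lambda>w. w \<bullet> u) \<le> 0" using h by (simp add: integral_unique)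
  moreover have pos: "w \<bullet> u > 0" if "w \<in> cbox a b" for w using that ab(1) strict by blast
  then have "integral (cbox a b) (\<lambda>w. w \<bullet> u) \<ge> 0" by (intro integral_nonneg integrable_continuous[OF cont]) (auto simp: less_imp_le)
  ultimately have "\<forall>w\<in>cbox a b. w \<bullet> u = 0"
    using integral_cbox_eq_0_iff[OF cont ab(2)] pos by (simp add: less_imp_le)
  then show False using pos ab(2) box_subset_cbox[of a b] by fastforce
qed

lemma dual_linear_image_hull:
  assumes "linear f"
  shows "w \<in> dual (f ` (convex hull S)) \<longleftrightarrow> (\<forall>v\<in>S. w \<bullet> f v \<ge> -1)"
proof
  assume "\<forall>v\<in>S. w \<bullet> f v \<ge> -1"
  then have "f ` S \<subseteq> {x. w \<bullet> x \<ge> -1}" by auto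
  then have "convex hull (f ` S) \<subseteq> {x. w \<bullet> x \<ge> -1}" by (intro hull_minimal convex_halfspace_ge)
  then show "w \<in> dual (f ` (convex hull S))"
    by (auto simp: dual_def convex_hull_linear_image[OF assms])
qed (auto simp: dual_def hull_inc)

text \<open>
  Let \<open>s\<close> and \<open>d\<close> be the pairings with the vectors that \<open>A\<close> maps to
  \<open>(1, 1)\<close> and \<open>(1, -1)\<close>. The dual polygon is the kite
  \<open>-2 + M \<bar>d\<bar> \<le> s \<le> 2 - N \<bar>d\<bar>\<close> with
  \<open>M = 2 m + 1\<close> and \<open>N = 2 n + 1\<close>. Since \<open>N < M\<close>, its part
  with \<open>s < 0\<close> is thinner than its part with \<open>s > 0\<close>, so it is lopsided in the
  direction of \<open>s\<close>.
\<close>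

lemma equivalent_P_mn_not_kaehler_einstein:
  assumes P: "fano_polygon P" and A: "A \<in> carrier GL2Z" "act A ` P = P_mn m n" and mn: "n < m" "0 \<le> n"
  shows "\<not> kaehler_einstein P"
proof -
  obtain B where B: "\<And>x. act A (act B x) = x" "\<And>x. act B (act A x) = x"
    using GL2Z_obtain_inverse[OF A(1)] by metis
  have PB: "P = act B ` P_mn m n" unfolding A(2)[symmetric] by (simp add: image_image B)
  define a b where "a w = w \<bullet> act B (vector [1, 0])" "b w = w \<bullet> act B (vector [0, 1])" for w :: "real^2"
  note ab = this
  have pair: "w \<bullet> act B (vector [x, y]) = x * a w + y * b w" for w x y
  proof -
    have "vector [x, y] = x *\<^sub>R vector [1, 0] + y *\<^sub>R (vector [0, 1] :: real^2)"
      by (simp add: vec_eq_iff forall_2)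
    then show ?thesis by (simp add: ab linear_add[OF linear_act] linear_scale[OF linear_act] inner_add_right)
  qed
  define M N where "M = 2 * real_of_int m + 1" "N = 2 * real_of_int n + 1"
  note MN = this
  have MNpos: "0 < N" "N < M" using mn by (simp_all add: MN)
  define s d where "s w = a w + b w" "d w = a w - b w" for w
  note sd = this
  have D: "w \<in> dual P \<longleftrightarrow> s w + M * d w \<ge> -2 \<and> s w - M * d w \<ge> -2 \<and> s w + N * d w \<le> 2 \<and> s w - N * d w \<le> 2" for w
    unfolding PB P_mn_def dual_linear_image_hull[OF linear_act]
    by (simp add: pair sd MN) (simp add: algebra_simps; linarith)
  \<comment> \<open>Interior points of the kite with \<open>s > 0\<close> whose negatives violate the first of its four inequalities.\<close>
  define U where "U = {w. s w > 0} \<inter> {w. s w + M * d w > 2} \<inter> {w. s w - M * d w > -2} \<inter> 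
    {w. s w + N * d w < 2} \<inter> {w. s w - N * d w < 2}"
  have "open U" unfolding U_def sd ab
    by (intro open_Int open_Collect_less continuous_intros)
  have neg: "s (- w) = - s w" "d (- w) = - d w" for w by (simp_all add: sd ab)
  \<comment> \<open>The point with \<open>d = 2 / M\<close> and \<open>s\<close> halfway between \<open>0 = 2 - M * d\<close> and \<open>2 - N * d\<close>.\<close>
  define w0 where "w0 = vector [1/2 - N/(2*M) + 1/M, 1/2 - N/(2*M) - 1/M] v* map_matrix real_of_int A"
  have w0: "w0 \<bullet> act B (vector [x, y]) = (1/2 - N/(2*M) + 1/M) * x + (1/2 - N/(2*M) - 1/M) * y" for x y
    unfolding w0_def dot_lmul_matrix using B(1)[of "vector [x, y]"]
    by (simp add: act_def inner_vec_def sum_2)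
  have "s w0 = 1 - N/M" "d w0 = 2/M"
    by (simp_all add: sd ab w0)
  then have "s w0 = 1 - N/M" "M * d w0 = 2" "N * d w0 = 2 * (N/M)" using MNpos by simp_all
  moreover have "0 < N/M" "N/M < 1" using MNpos by simp_all
  ultimately have "w0 \<in> U" unfolding U_def by simp
  have "barycenter (dual P) \<noteq> 0"
  proof (rule barycenter_nonzero_if_lopsided[OF compact_dual \<open>open U\<close>, of _ "act B (vector [1, 1])"])
    show "0 \<in> interior P" using fano_polygonD[OF P] by simp
    show "U \<noteq> {}" using \<open>w0 \<in> U\<close> by blast
    show "U \<subseteq> dual P" by (auto simp: U_def D)
    fix w
    have sw: "w \<bullet> act B (vector [1, 1]) = s w" by (simp add: pair sd)
    { assume w: "w \<in> dual P" "w \<bullet> act B (vector [1, 1]) < 0"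
      have "\<bar>N * d w\<bar> \<le> \<bar>M * d w\<bar>" using MNpos by (simp add: abs_mult mult_right_mono)
      then show "- w \<in> dual P"
        using w unfolding D sw neg mult_minus_right by (intro conjI; linarith) }
    { assume "w \<in> U"
      then show "w \<bullet> act B (vector [1, 1]) > 0 \<and> - w \<notin> dual P"
        unfolding sw D U_def neg by auto }
  qed
  then show ?thesis by (simp add: kaehler_einstein_def)
qed

section \<open>Lattice symmetric polygons that are not symmetric\<close>

lemma act_in_lattice: "x \<in> lattice \<Longrightarrow> act A x \<in> lattice"
  by (auto simp: lattice_def forall_2 act_nth)

lemma act_uminus_matrix: "act (- A) x = - act A x"
  by (simp add: vec_eq_iff forall_2 act_nth)

text \<open>
  Up to the unimodular map \<open>-I\<close>, the larger parameter may be taken first.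
\<close>

lemma uminus_P_mn: "uminus ` P_mn m n = P_mn n m"
proof -
  have "uminus ` P_mn m n = convex hull (uminus ` {vector [of_int (m + 1), of_int (- m)], vector [of_int (- m), of_int (m + 1)],
      vector [of_int (- n - 1), of_int n], vector [of_int n, of_int (- n - 1)] :: real^2})"
    unfolding P_mn_def by (rule convex_hull_linear_image) (rule linear_uminus)
  also have "uminus ` {vector [of_int (m + 1), of_int (- m)], vector [of_int (- m), of_int (m + 1)],
      vector [of_int (- n - 1), of_int n], vector [of_int n, of_int (- n - 1)] :: real^2}
    = {vector [of_int (n + 1), of_int (- n)], vector [of_int (- n), of_int (n + 1)],
      vector [of_int (- m - 1), of_int m], vector [of_int m, of_int (- m - 1)]}"
  proof -
    have neg: "- vector [of_int (m + 1), of_int (- m)] = (vector [of_int (- m - 1), of_int m] :: real^2)"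
      "- vector [of_int (- m), of_int (m + 1)] = (vector [of_int m, of_int (- m - 1)] :: real^2)"
      "- vector [of_int (- n - 1), of_int n] = (vector [of_int (n + 1), of_int (- n)] :: real^2)"
      "- vector [of_int n, of_int (- n - 1)] = (vector [of_int (- n), of_int (n + 1)] :: real^2)"
      by (simp_all add: vec_eq_iff forall_2)
    show ?thesis unfolding image_insert image_empty neg by blast
  qed
  finally show ?thesis by (simp add: P_mn_def)
qed

text \<open>
  In a basis that puts the generating reflection into normal form, the diagonal form would produce a nonzero
  fixed lattice point, and the swap leads to \<open>P_mn m n\<close>. Central symmetry is impossible because
  \<open>-I\<close> has determinant one and so is not in \<open>{I, R}\<close>.
\<close>

lemma not_symmetric_equivalent_P_mn:
  assumes P: "fano_polygon P" "lattice_symmetric P" "\<not> symmetric P"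
  obtains A m n where "A \<in> carrier GL2Z" "act A ` P = P_mn m n" "0 \<le> n" "n < m"
proof -
  obtain R where R: "R \<in> carrier GL2Z" "det R = -1" "R$1$1 + R$2$2 = 0" "carrier (Aut P) = {mat 1, R}"
    using not_symmetric_Aut[OF P] .
  have RP: "act R ` P = P" using R(4) carrier_Aut by blast
  have fixed: "x = 0" if "x \<in> P" "x \<in> lattice" "act R x = x" for x
    using that P(2) R(4) by (auto simp: lattice_symmetric_def fixed_points_def)
  obtain B where B: "B \<in> carrier GL2Z" "R ** B = B ** diag_matrix \<or> R ** B = B ** swap_matrix"
    using reflection_normal_form[OF R(2,3)] .
  obtain C where C: "C \<in> carrier GL2Z" "B ** C = mat 1" "C ** B = mat 1"
    "\<And>x. act B (act C x) = x" "\<And>x. act C (act B x) = x"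
    using GL2Z_obtain_inverse[OF B(1)] by metis
  define Q where "Q = act C ` P"
  have Q: "fano_polygon Q" using fano_polygon_act[OF C(1) P(1)] by (simp add: Q_def)
  have conj: "act N (act C x) = act C (act R x)" "act B (act N x) = act R (act B x)" if "R ** B = B ** N" for N x
  proof -
    show *: "act B (act N x) = act R (act B x)" for x using that act_mult by metis
    show "act N (act C x) = act C (act R x)" using *[of "act C x"] C(4,5) by metis
  qed
  have inv: "act N ` Q = Q" if "R ** B = B ** N" for N
  proof -
    have "act N ` Q = act C ` act R ` P" by (simp add: Q_def image_image conj[OF that])
    then show ?thesis by (simp add: RP Q_def)
  qed
  have fix0: "x = 0" if "R ** B = B ** N" "x \<in> Q" "x \<in> lattice" "act N x = x" for N x
  proof -
    have "act B x \<in> P" using that(2) C(4) by (auto simp: Q_def)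
    moreover have "act R (act B x) = act B x" using conj(2)[OF that(1)] that(4) by metis
    ultimately have "act B x = 0" using fixed act_in_lattice[OF that(3)] by blast
    then show ?thesis using C(5)[of x] linear_0[OF linear_act] by metis
  qed
  have ne1: "R ** B \<noteq> B ** diag_matrix"
  proof
    assume N: "R ** B = B ** diag_matrix"
    have "vector [1, 0] = (0 :: real^2)"
      by (rule fix0[OF N fano_diagonal_reflection_fixes_lattice_point[OF Q inv[OF N]]])
        (simp_all add: lattice_def vec_eq_iff forall_2 act_nth)
    then show False by (simp add: vec_eq_iff forall_2)
  qed
  with B have N: "R ** B = B ** swap_matrix" by blast
  have u: "vector [1, 1] \<notin> Q" "vector [-1, -1] \<notin> Q"
    using fix0[OF N, of "vector [1, 1]"] fix0[OF N, of "vector [-1, -1]"]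
    by (auto simp: lattice_def vec_eq_iff forall_2 act_nth)
  have asym: "uminus ` Q \<noteq> Q"
  proof
    assume *: "uminus ` Q = Q"
    have "act (- mat 1) ` P = P"
    proof -
      have "P = act B ` Q" by (simp add: Q_def image_image C)
      moreover have "uminus ` act B ` Q = act B ` uminus ` Q" by (simp add: image_image linear_neg[OF linear_act])
      ultimately show ?thesis using * by (simp add: act_uminus_matrix)
    qed
    then have "- mat 1 \<in> carrier (Aut P)" by (simp add: carrier_Aut GL2Z_I det_2)
    then have "- mat 1 = (mat 1 :: int^2^2) \<or> - mat 1 = R" using R(4) by blast
    then have "- mat 1 = R" by (auto simp: mat_eq_iff_2)
    then have "det (- mat 1 :: int^2^2) = -1" using R(2) by simp
    then show False by (simp add: det_2)
  qed
  obtain m n where mn: "m \<ge> 0" "n \<ge> 0" "m \<noteq> n" "act C ` P = P_mn m n"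
    using swap_invariant_fano_polygon[OF Q inv[OF N] u asym] by (auto simp: Q_def)
  show ?thesis
  proof (cases "n < m")
    case True
    then show ?thesis using that C(1) mn by blast
  next
    case False
    have "- C \<in> carrier GL2Z" using det_GL2Z[OF C(1)] by (intro GL2Z_I) (simp add: det_2)
    moreover have "act (- C) ` P = uminus ` act C ` P"
      by (simp add: image_image act_uminus_matrix)
    then have "act (- C) ` P = P_mn n m" by (simp only: mn(4) uminus_P_mn)
    ultimately show ?thesis using that[of "- C" n m] mn False by simp
  qed
qed

theorem theorem1p6:
  fixes P :: "(real^2) set"
  assumes "fano_polygon P" and "lattice_symmetric P"
  shows "(\<not> symmetric P \<longleftrightarrow>
           Aut P \<cong> integer_mod_group 2 \<and>
           (\<exists>R. reflection R \<and> carrier (Aut P) = generate (Aut P) {R}))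
         \<and> (\<not> symmetric P \<longrightarrow>
           (\<exists>m n :: int. m \<noteq> n \<and> unimodularly_equivalent P (P_mn m n)) \<and>
           \<not> kaehler_einstein P)"
proof (intro conjI impI iffI)
  assume ns: "\<not> symmetric P"
  obtain R where R: "R \<in> carrier GL2Z" "det R = -1" "R$1$1 + R$2$2 = 0" "carrier (Aut P) = {mat 1, R}"
    using not_symmetric_Aut[OF assms ns] .
  have RR: "R ** R = mat 1" using reflection_square[OF R(2,3)] .
  have "R \<noteq> mat 1" using R(2) by (metis det_I one_neq_neg_one)
  then show "Aut P \<cong> integer_mod_group 2"
    using group_order_two_iso[OF group_Aut[of P], of R] R(4) RR by simp
  show "\<exists>R. reflection R \<and> carrier (Aut P) = generate (Aut P) {R}"
    using order_two_generate[OF group_Aut[of P], of R] R RR reflection_iff by auto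
  obtain A m n where A: "A \<in> carrier GL2Z" "act A ` P = P_mn m n" "0 \<le> n" "n < m"
    using not_symmetric_equivalent_P_mn[OF assms ns] .
  then show "\<exists>m n :: int. m \<noteq> n \<and> unimodularly_equivalent P (P_mn m n)"
    unfolding unimodularly_equivalent_def by (metis less_irrefl)
  show "\<not> kaehler_einstein P"
    using equivalent_P_mn_not_kaehler_einstein[OF assms(1) A(1,2,4,3)] .
next
  assume "Aut P \<cong> integer_mod_group 2 \<and> (\<exists>R. reflection R \<and> carrier (Aut P) = generate (Aut P) {R})"
  then show "\<not> symmetric P" using reflection_group_not_symmetric by blast
qed

end
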